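(* Let $K\in\mathbb{R}^{n\times n}$ be a symmetric positive definite matrix with eigendecomposition $K=\sum_{\ell=1}^n\lambda_\ell \bm{v}_\ell\bm{v}_\ell^\top$, where $\lambda_1\ge\dots\ge\lambda_n$ and $\bm{v}_1,\dots,\bm{v}_n$ is an orthonormal basis of eigenvectors. Let $1\le k\le n$ be an integer, let $\mathcal{C}\sim kDPP(K)$, and set $\alpha=\sum_{i=k}^n\lambda_i$. Then $$\mathbb{E}_{C}\big[C K_{\mathcal{C}\mathcal{C}}^{-1}C^\top\big] \succeq \sum_{\ell=1}^{n} \frac{\bm{v}_\ell \bm{v}_\ell^\top}{\lambda_\ell +\alpha},$$ where $A\succeq B$ means that $A-B$ is positive semidefinite.
   Context: Write $[n]=\{1,\dots,n\}$. For a subset $\mathcal{C}\subseteq[n]$, $C$ denotes the $n\times|\mathcal{C}|$ sampling matrix obtained by selecting the columns of the $n\times n$ identity matrix indexed by $\mathcal{C}$, and $K_{\mathcal{C}\mathcal{C}}=C^\top K C$ is the corresponding principal submatrix. $e_k(K)=\sum_{1\le i_1<\dots<i_k\le n}\lambda_{i_1}\cdots\lambda_{i_k}$ is the $k$-th elementary symmetric polynomial of the eigenvalues of $K$. $kDPP(K)$ is the probability distribution on subsets $\mathcal{C}\subseteq[n]$ of fixed size $|\mathcal{C}|=k$ given by $\Pr(Y=\mathcal{C})=\det(K_{\mathcal{C}\mathcal{C}})/e_k(K)$. The expectation $\mathbb{E}_C$ is over the random subset $\mathcal{C}$ (equivalently, over its sampling matrix $C$). *)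

theory Defs
  imports
    "HOL-Probability.Probability_Mass_Function"
    "Jordan_Normal_Form.Char_Poly"
    "Jordan_Normal_Form.Gauss_Jordan_Elimination"
begin

unbundle no vec_syntax

(* Coordinates of vectors and matrices run over 0..<n, so the ground set [n] = {1..n} of the
   mathematics is represented by {0..<n}. *)

definition symmetric_mat :: "'a mat \<Rightarrow> bool" where
  "symmetric_mat A \<longleftrightarrow> square_mat A \<and> transpose_mat A = A"

definition positive_definite :: "real mat \<Rightarrow> bool" where
  "positive_definite A \<longleftrightarrow> symmetric_mat A \<and>
     (\<forall>x \<in> carrier_vec (dim_row A). x \<noteq> 0\<^sub>v (dim_row A) \<longrightarrow> x \<bullet> (A *\<^sub>v x) > 0)"

definition positive_semidefinite :: "real mat \<Rightarrow> bool" where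
  "positive_semidefinite A \<longleftrightarrow> symmetric_mat A \<and>
     (\<forall>x \<in> carrier_vec (dim_row A). x \<bullet> (A *\<^sub>v x) \<ge> 0)"

definition loewner_ge :: "real mat \<Rightarrow> real mat \<Rightarrow> bool" (infix \<open>\<succeq>\<^sub>L\<close> 50) where
  "A \<succeq>\<^sub>L B \<longleftrightarrow> positive_semidefinite (A - B)"

definition outer_prod :: "'a :: times vec \<Rightarrow> 'a vec \<Rightarrow> 'a mat" where
  "outer_prod u v = mat (dim_vec u) (dim_vec v) (\<lambda>(i, j). u $ i * v $ j)"

(* The type of matrices of arbitrary dimensions is no additive monoid, so the sum of a family
   of n x n matrices needs its own definition. *)
definition mat_sum :: "nat \<Rightarrow> ('i \<Rightarrow> 'a :: comm_monoid_add mat) \<Rightarrow> 'i set \<Rightarrow> 'a mat" where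
  "mat_sum n f I = mat n n (\<lambda>ij. \<Sum>l\<in>I. f l $$ ij)"

definition orthonormal_family :: "nat \<Rightarrow> 'i set \<Rightarrow> ('i \<Rightarrow> real vec) \<Rightarrow> bool" where
  "orthonormal_family n I v \<longleftrightarrow> (\<forall>i\<in>I. v i \<in> carrier_vec n) \<and>
     (\<forall>i\<in>I. \<forall>j\<in>I. v i \<bullet> v j = (if i = j then 1 else 0))"

definition sampling_matrix :: "nat \<Rightarrow> nat set \<Rightarrow> real mat" where
  "sampling_matrix n \<C> = mat_of_cols n (map (unit_vec n) (sorted_list_of_set \<C>))"

definition principal_submatrix :: "real mat \<Rightarrow> nat set \<Rightarrow> real mat" where
  "principal_submatrix K \<C> =
     transpose_mat (sampling_matrix (dim_row K) \<C>) * K * sampling_matrix (dim_row K) \<C>"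

(* Arbitrary for singular matrices. *)
definition mat_inv :: "'a :: field mat \<Rightarrow> 'a mat" where
  "mat_inv A = the (mat_inverse A)"

(* Real eigenvalues, repeated according to their algebraic multiplicity; for a symmetric
   matrix these are all n eigenvalues. *)
definition eigenvalue_list :: "real mat \<Rightarrow> real list" where
  "eigenvalue_list K = sorted_list_of_multiset (proots (char_poly K))"

definition elem_sym :: "nat \<Rightarrow> real mat \<Rightarrow> real" where
  "elem_sym k K = (let xs = eigenvalue_list K in
     \<Sum>I | I \<subseteq> {0..<length xs} \<and> card I = k. \<Prod>i\<in>I. xs ! i)"

(* For positive definite K and k \<le> n the weights are nonnegative and sum to 1, because e_k(K)
   is the sum of the principal minors of size k; for other arguments the distribution is
   unspecified. *)
definition kDPP :: "nat \<Rightarrow> real mat \<Rightarrow> nat set pmf" where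
  "kDPP k K = embed_pmf (\<lambda>\<C>. if \<C> \<subseteq> {0..<dim_row K} \<and> card \<C> = k
     then det (principal_submatrix K \<C>) / elem_sym k K else 0)"

definition expectation_mat :: "nat \<Rightarrow> 'a pmf \<Rightarrow> ('a \<Rightarrow> real mat) \<Rightarrow> real mat" where
  "expectation_mat n p X = mat n n (\<lambda>ij. measure_pmf.expectation p (\<lambda>\<omega>. X \<omega> $$ ij))"

end

theory Submission
  imports Defs
begin

text \<open>
  Let \<open>E\<^sub>k(A)\<close> be the sum of the principal \<open>k\<close>-minors of \<open>A\<close>, the coefficient of \<open>s ^ k\<close> in
  \<open>det (1 + s A)\<close>. By the matrix determinant lemma applied to every principal submatrix, the
  quadratic form of the expectation at \<open>x\<close> equals \<open>(E\<^sub>k(K + x x\<^sup>T) - E\<^sub>k(K)) / e\<^sub>k(K)\<close>. Applying the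
  same lemma to \<open>1 + s (K + x x\<^sup>T)\<close> in the eigenbasis shows that \<open>(x \<bullet> v\<^sub>l)\<^sup>2\<close> has coefficient
  \<open>a\<^sub>l / e\<^sub>k\<close> in this quotient, where \<open>a\<^sub>l\<close> is the elementary symmetric polynomial of degree \<open>k - 1\<close>
  in the eigenvalues other than \<open>\<lambda>\<^sub>l\<close>. Finally \<open>e\<^sub>k = \<lambda>\<^sub>l a\<^sub>l + b\<^sub>l\<close>, where \<open>b\<^sub>l\<close> has degree \<open>k\<close> in the other
  eigenvalues, and \<open>b\<^sub>l \<le> \<alpha> a\<^sub>l\<close> because the largest index of a \<open>k\<close>-subset of \<open>{1..n}\<close> is at
  least \<open>k\<close>.
\<close>

unbundle no inner_syntax

subsection \<open>Elementary symmetric polynomials\<close>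

text \<open>Unlike \<open>elem_sym\<close>, which is tied to the eigenvalue list of a matrix, this
  takes any index set, so that a single eigenvalue can be left out.\<close>

definition esym :: "nat \<Rightarrow> 'i set \<Rightarrow> ('i \<Rightarrow> 'a :: comm_semiring_1) \<Rightarrow> 'a" where
  "esym k I f = (\<Sum>S | S \<subseteq> I \<and> card S = k. \<Prod>i\<in>S. f i)"

lemma prod_monom_Suc_0: "(\<Prod>i\<in>S. monom (f i) (Suc 0)) = monom (\<Prod>i\<in>S. f i) (card S)"
  by (induction S rule: infinite_finite_induct) (auto simp: mult_monom)

text \<open>Expanding the product means choosing 1 or the linear term in each factor; degree
  \<open>k\<close> comes from the \<open>k\<close>-subsets. Identities between symmetric sums thus
  reduce to identities between products.\<close>

lemma coeff_prod_linear:
  fixes f :: "'i \<Rightarrow> 'a :: comm_semiring_1"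
  assumes "finite I"
  shows "coeff (\<Prod>i\<in>I. [:1, f i:]) k = esym k I f"
proof -
  have "(\<Prod>i\<in>I. [:1, f i:]) = (\<Prod>i\<in>I. monom (f i) (Suc 0) + 1)"
    by (intro prod.cong) (auto simp: monom_Suc one_pCons monom_0)
  also have "\<dots> = (\<Sum>S\<in>Pow I. monom (\<Prod>i\<in>S. f i) (card S))"
    by (subst prod_add[OF assms]) (simp add: prod_monom_Suc_0)
  finally have "coeff (\<Prod>i\<in>I. [:1, f i:]) k
      = (\<Sum>S\<in>Pow I. if card S = k then \<Prod>i\<in>S. f i else 0)"
    by (simp add: coeff_sum)
  also have "\<dots> = esym k I f"
    using assms by (simp add: esym_def sum.If_cases Int_def)
  finally show ?thesis .
qed

lemma esym_pos:
  fixes f :: "'i \<Rightarrow> 'a :: linordered_idom"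
  assumes "finite I" and "\<And>i. i \<in> I \<Longrightarrow> 0 < f i" and "k \<le> card I"
  shows "0 < esym k I f"
proof -
  obtain S where "S \<subseteq> I" "card S = k"
    using assms(3) by (meson obtain_subset_with_card_n)
  then show ?thesis
    unfolding esym_def using assms(1,2) by (intro sum_pos) (auto intro!: prod_pos)
qed

text \<open>Splits off the factor \<open>[:1, f l:]\<close> of the generating product; the two terms
  count the subsets that contain \<open>l\<close> and those that do not.\<close>

lemma esym_Suc_remove:
  assumes "finite I" and "l \<in> I"
  shows "esym (Suc k) I f = f l * esym k (I - {l}) f + esym (Suc k) (I - {l}) f"
proof -
  have "coeff (\<Prod>i\<in>I. [:1, f i:]) (Suc k) =
      coeff ([:1, f l:] * (\<Prod>i\<in>I - {l}. [:1, f i:])) (Suc k)"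
    using assms by (simp add: prod.remove)
  then show ?thesis
    using assms by (simp add: coeff_prod_linear add.commute)
qed

text \<open>A set of \<open>Suc k\<close> positive indices has its maximum above \<open>k\<close>, so it is determined by a \<open>k\<close>-set
  and one index above \<open>k\<close>.\<close>
lemma esym_Suc_le:
  fixes f :: "nat \<Rightarrow> 'a :: linordered_idom"
  assumes "finite I" and "0 \<notin> I" and "I \<subseteq> J" and "finite J" and nonneg: "\<And>i. i \<in> J \<Longrightarrow> 0 \<le> f i"
  shows "esym (Suc k) I f \<le> esym k I f * (\<Sum>i | i \<in> J \<and> k < i. f i)"
proof -
  let ?A = "{S. S \<subseteq> I \<and> card S = Suc k}" and ?B = "{S. S \<subseteq> I \<and> card S = k}"
  let ?C = "{i. i \<in> J \<and> k < i}" and ?g = "\<lambda>S. (S - {Max S}, Max S)"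
  have fin: "finite S" if "S \<in> ?A" for S
    using that card.infinite by fastforce
  have Max: "Max S \<in> S" if "S \<in> ?A" for S
    using that fin[OF that] by (intro Max_in) auto
  have large: "k < Max S" if S: "S \<in> ?A" for S
  proof -
    \<comment> \<open>Here 0 must be excluded: with it, \<open>Suc k\<close> indices could have
      maximum \<open>k\<close>.\<close>
    have "S \<subseteq> {1..Max S}"
      using S assms(2) Max_ge[OF fin[OF S]] by (auto simp: Suc_le_eq intro!: gr0I)
    then have "card S \<le> Max S"
      using card_mono[of "{1..Max S}" S] by simp
    then show ?thesis using S by simp
  qed
  have inj: "inj_on ?g ?A"
    using Max by (intro inj_onI) (metis Pair_inject insert_Diff)
  have "esym (Suc k) I f = (\<Sum>S\<in>?A. (\<lambda>(T, i). (\<Prod>j\<in>T. f j) * f i) (?g S))"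
    unfolding esym_def
  proof (intro sum.cong refl)
    fix S assume S: "S \<in> ?A"
    show "prod f S = (case ?g S of (T, i) \<Rightarrow> prod f T * f i)"
      using prod.remove[OF fin[OF S] Max[OF S], of f] by (simp add: mult.commute)
  qed
  also have "\<dots> = (\<Sum>(T, i)\<in>?g ` ?A. (\<Prod>j\<in>T. f j) * f i)"
    by (simp add: sum.reindex[OF inj])
  \<comment> \<open>The product set also has pairs that come from no \<open>S\<close>, such as those
    with \<open>i\<close> in \<open>T\<close>, below the maximum of \<open>T\<close>, or outside
    \<open>I\<close>. They only add nonnegative terms.\<close>
  also have "\<dots> \<le> (\<Sum>(T, i)\<in>?B \<times> ?C. (\<Prod>j\<in>T. f j) * f i)"
  proof (rule sum_mono2)
    show "finite (?B \<times> ?C)"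
      using assms by auto
    show "?g ` ?A \<subseteq> ?B \<times> ?C"
    proof
      fix p assume "p \<in> ?g ` ?A"
      then obtain S where S: "S \<in> ?A" and p: "p = ?g S" by blast
      have "card (S - {Max S}) = k"
        using S Max[OF S] fin[OF S] by (simp add: card_Diff_singleton)
      then show "p \<in> ?B \<times> ?C"
        using S Max[OF S] large[OF S] assms(3) by (auto simp: p)
    qed
    show "0 \<le> (case p of (T, i) \<Rightarrow> prod f T * f i)" if "p \<in> ?B \<times> ?C - ?g ` ?A" for p
      using that assms(3) nonneg by (auto intro!: mult_nonneg_nonneg prod_nonneg)
  qed
  also have "\<dots> = esym k I f * (\<Sum>i\<in>?C. f i)"
    by (simp add: esym_def sum_product sum.cartesian_product)
  finally show ?thesis .
qed

subsection \<open>Determinant identities\<close>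

text \<open>Each factor of the Leibniz product is an entry of the identity plus \<open>s\<close>
  times an entry of \<open>A\<close>; \<open>S\<close> collects the indices at which the second is
  chosen.\<close>

lemma det_one_add_smult:
  fixes A :: "'a :: comm_ring_1 mat"
  assumes A: "A \<in> carrier_mat n n"
  shows "det (1\<^sub>m n + s \<cdot>\<^sub>m A) =
    (\<Sum>S\<in>Pow {0..<n}. s ^ card S * (\<Sum>p | p permutes S. signof p * (\<Prod>i\<in>S. A $$ (i, p i))))"
proof -
  let ?U = "{0..<n}"
  have fin: "finite S" if "S \<subseteq> ?U" for S
    using that finite_subset by blast
  have "det (1\<^sub>m n + s \<cdot>\<^sub>m A) =
      (\<Sum>p | p permutes ?U. signof p * (\<Prod>i\<in>?U. s * A $$ (i, p i) + (if i = p i then 1 else 0)))"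
    using A by (subst det_def'[of _ n], simp)
      (intro sum.cong refl arg_cong2[where f = "(*)"] prod.cong,
       auto simp: permutes_in_image[of _ ?U, simplified] add.commute)
  also have "\<dots> = (\<Sum>p | p permutes ?U. \<Sum>S\<in>Pow ?U. signof p *
      ((\<Prod>i\<in>S. s * A $$ (i, p i)) * (\<Prod>i\<in>?U - S. if i = p i then 1 else 0)))"
    by (subst prod_add) (simp_all add: sum_distrib_left)
  also have "\<dots> = (\<Sum>S\<in>Pow ?U. \<Sum>p | p permutes ?U. signof p *
      ((\<Prod>i\<in>S. s * A $$ (i, p i)) * (\<Prod>i\<in>?U - S. if i = p i then 1 else 0)))"
    by (rule sum.swap)
  also have "\<dots> = (\<Sum>S\<in>Pow ?U. \<Sum>p | p permutes S. signof p * (\<Prod>i\<in>S. s * A $$ (i, p i)))"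
  proof (rule sum.cong[OF refl], rule sum.mono_neutral_cong_right)
    fix S assume "S \<in> Pow ?U"
    then have S: "S \<subseteq> ?U" by simp
    show "finite {p. p permutes ?U}"
      by (simp add: finite_permutations)
    show "{p. p permutes S} \<subseteq> {p. p permutes ?U}"
      using S permutes_subset by blast
    \<comment> \<open>A permutation that moves an index outside \<open>S\<close> picks up an
      off-diagonal zero of the identity there.\<close>
    show "\<forall>p\<in>{p. p permutes ?U} - {p. p permutes S}. signof p *
      ((\<Prod>i\<in>S. s * A $$ (i, p i)) * (\<Prod>i\<in>?U - S. if i = p i then 1 else 0)) = 0"
    proof
      fix p assume "p \<in> {p. p permutes ?U} - {p. p permutes S}"
      then obtain i where "i \<in> ?U - S" "p i \<noteq> i"
        using permutes_superset[of p ?U S] by auto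
      then have "(\<Prod>i\<in>?U - S. if i = p i then 1 else 0 :: 'a) = 0"
        by (intro prod_zero) (auto intro!: bexI[of _ i])
      then show "signof p * ((\<Prod>i\<in>S. s * A $$ (i, p i)) *
        (\<Prod>i\<in>?U - S. if i = p i then 1 else 0)) = 0" by simp
    qed
    fix p assume "p \<in> {p. p permutes S}"
    then have "(\<Prod>i\<in>?U - S. if i = p i then 1 else 0 :: 'a) = 1"
      by (intro prod.neutral) (auto simp: permutes_not_in)
    then show "signof p * ((\<Prod>i\<in>S. s * A $$ (i, p i)) *
        (\<Prod>i\<in>?U - S. if i = p i then 1 else 0)) = signof p * (\<Prod>i\<in>S. s * A $$ (i, p i))"
      by simp
  qed
  also have "\<dots> = (\<Sum>S\<in>Pow ?U. s ^ card S *
      (\<Sum>p | p permutes S. signof p * (\<Prod>i\<in>S. A $$ (i, p i))))"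
    by (simp add: prod.distrib sum_distrib_left mult.left_commute)
  finally show ?thesis .
qed

text \<open>Conjugation by \<open>f\<close> matches the permutations of the two index sets and
  preserves signs. This links submatrices, indexed from 0, with Leibniz sums over permutations of
  the subset itself.\<close>

lemma det_reindex:
  fixes A :: "'a :: comm_ring_1 mat"
  assumes f: "bij_betw f {0..<k} C"
  shows "det (mat k k (\<lambda>(i, j). A $$ (f i, f j))) =
    (\<Sum>p | p permutes C. signof p * (\<Prod>i\<in>C. A $$ (i, p i)))"
proof -
  let ?U = "{0..<k}" and ?g = "inv_into {0..<k} f"
  have g: "bij_betw ?g C ?U" using f by (rule bij_betw_inv_into)
  have inj: "inj_on f ?U" using f by (simp add: bij_betw_def)
  have "det (mat k k (\<lambda>(i, j). A $$ (f i, f j))) =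
    (\<Sum>p | p permutes ?U. signof p * (\<Prod>i\<in>?U. A $$ (f i, f (p i))))"
    by (subst det_def'[of _ k], simp)
      (intro sum.cong refl arg_cong2[where f = "(*)"] prod.cong,
       auto simp: permutes_in_image[of _ ?U, simplified])
  also have "\<dots> = (\<Sum>p | p permutes C. signof p * (\<Prod>i\<in>C. A $$ (i, p i)))"
  proof (rule sum.reindex_bij_witness[of _ "map_permutation C ?g" "map_permutation ?U f"])
    fix p assume "p \<in> {p. p permutes ?U}"
    then have p: "p permutes ?U" by simp
    show "map_permutation C ?g (map_permutation ?U f p) = p"
      by (rule map_permutation_compose_inv[OF f p]) (simp add: inj)
    show "map_permutation ?U f p \<in> {p. p permutes C}"
      using map_permutation_permutes[OF f p] by simp
    have "(\<Prod>i\<in>C. A $$ (i, map_permutation ?U f p i)) =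
        (\<Prod>i\<in>?U. A $$ (f i, map_permutation ?U f p (f i)))"
      by (rule prod.reindex_bij_betw[OF f, symmetric])
    also have "\<dots> = (\<Prod>i\<in>?U. A $$ (f i, f (p i)))"
      by (simp add: map_permutation_apply[OF inj])
    finally show "signof (map_permutation ?U f p) * (\<Prod>i\<in>C. A $$ (i, map_permutation ?U f p i)) =
        signof p * (\<Prod>i\<in>?U. A $$ (f i, f (p i)))"
      by (simp add: sign_map_permutation[OF inj p])
  next
    fix q assume "q \<in> {p. p permutes C}"
    then have q: "q permutes C" by simp
    show "map_permutation ?U f (map_permutation C ?g q) = q"
      by (rule map_permutation_compose_inv[OF g q]) (use f in \<open>auto simp: bij_betw_def f_inv_into_f\<close>)
    show "map_permutation C ?g q \<in> {p. p permutes ?U}"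
      using map_permutation_permutes[OF g q] by simp
  qed
  finally show ?thesis .
qed

text \<open>The Weinstein-Aronszajn identity. The blocks of \<open>?X\<close> and \<open>?Y\<close>
  are chosen so that both \<open>?X * ?Y\<close> and \<open>?Y * ?X\<close> are block lower
  triangular, each with one side of the claim as determinant.\<close>

lemma det_one_add_mult_commute:
  fixes M N :: "'a :: idom mat"
  assumes M: "M \<in> carrier_mat n m" and N: "N \<in> carrier_mat m n"
  shows "det (1\<^sub>m n + M * N) = det (1\<^sub>m m + N * M)"
proof -
  let ?X = "four_block_mat (1\<^sub>m n) (- M) N (1\<^sub>m m)"
  let ?Y = "four_block_mat (1\<^sub>m n) M (0\<^sub>m m n) (1\<^sub>m m)"
  have X: "?X \<in> carrier_mat (n + m) (n + m)" and Y: "?Y \<in> carrier_mat (n + m) (n + m)"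
    by auto
  have detY: "det ?Y = 1"
    using det_four_block_mat_lower_left_zero[of "1\<^sub>m n" n M m "0\<^sub>m m n" "1\<^sub>m m"] M by simp
  have "?X * ?Y = four_block_mat (1\<^sub>m n) (0\<^sub>m n m) N (1\<^sub>m m + N * M)"
    using M N by (subst mult_four_block_mat[of _ n n _ m _ m _ _ n _ m])
      (auto intro!: cong_four_block_mat simp: comm_add_mat[of _ m m])
  then have "det (?X * ?Y) = det (1\<^sub>m m + N * M)"
    using det_four_block_mat_upper_right_zero[of "1\<^sub>m n" n "0\<^sub>m n m" m N "1\<^sub>m m + N * M"] M N by simp
  moreover have "?Y * ?X = four_block_mat (1\<^sub>m n + M * N) (0\<^sub>m n m) N (1\<^sub>m m)"
    using M N by (subst mult_four_block_mat[of _ n n _ m _ m _ _ n _ m])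
      (auto intro!: cong_four_block_mat)
  then have "det (?Y * ?X) = det (1\<^sub>m n + M * N)"
    using det_four_block_mat_upper_right_zero[of "1\<^sub>m n + M * N" n "0\<^sub>m n m" m N "1\<^sub>m m"] M N by simp
  ultimately show ?thesis
    using det_mult[OF X Y] det_mult[OF Y X] by (metis mult.commute)
qed

text \<open>The matrix determinant lemma: factor out \<open>A\<close>, then turn the rank-one
  determinant of size \<open>n\<close> into one of size 1. The inverse is a parameter because it is
  used both with \<open>mat_inv\<close> and with an inverse written in the eigenbasis.\<close>

lemma det_add_outer_prod:
  fixes A :: "'a :: idom mat"
  assumes A: "A \<in> carrier_mat n n" and B: "B \<in> carrier_mat n n" and AB: "A * B = 1\<^sub>m n"
    and u: "u \<in> carrier_vec n" and w: "w \<in> carrier_vec n"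
  shows "det (A + outer_prod u w) = det A * (1 + w \<bullet> (B *\<^sub>v u))"
proof -
  let ?M = "mat n 1 (\<lambda>(i, j). (B *\<^sub>v u) $ i)" and ?N = "mat 1 n (\<lambda>(i, j). w $ j)"
  let ?u = "mat n 1 (\<lambda>(i, j). u $ i)"
  have "B * ?u = ?M"
    using B u by (intro eq_matI) (auto simp: scalar_prod_def)
  then have "A * ?M = (A * B) * ?u"
    using assoc_mult_mat[OF A B, of ?u 1] by simp
  then have "A * ?M = ?u"
    using left_mult_one_mat[of ?u n 1] by (simp add: AB)
  moreover have "outer_prod u w = ?u * ?N"
    using u w by (intro eq_matI) (auto simp: outer_prod_def scalar_prod_def)
  ultimately have "A + outer_prod u w = A * 1\<^sub>m n + A * (?M * ?N)"
    using A assoc_mult_mat[of A n n ?M 1 ?N n] by simp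
  also have "\<dots> = A * (1\<^sub>m n + ?M * ?N)"
    using A by (intro mult_add_distrib_mat[symmetric]) auto
  finally have "det (A + outer_prod u w) = det A * det (1\<^sub>m n + ?M * ?N)"
    using A by (simp, intro det_mult[of _ n]) auto
  also have "det (1\<^sub>m n + ?M * ?N) = det (1\<^sub>m 1 + ?N * ?M)"
    by (rule det_one_add_mult_commute) auto
  also have "\<dots> = 1 + w \<bullet> (B *\<^sub>v u)"
    using B w by (subst det_single[of _ ]) (auto simp: scalar_prod_def)
  finally show ?thesis .
qed

subsection \<open>Quadratic forms\<close>

lemma quadratic_form_sum:
  fixes A :: "real mat"
  assumes "A \<in> carrier_mat n n" and "x \<in> carrier_vec n"
  shows "x \<bullet> (A *\<^sub>v x) = (\<Sum>i<n. \<Sum>j<n. x $ i * A $$ (i, j) * x $ j)"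
  using assms by (auto simp: scalar_prod_def atLeast0LessThan sum_distrib_left mult.assoc intro!: sum.cong)

lemma quadratic_form_smult:
  fixes A :: "real mat"
  assumes "A \<in> carrier_mat n n" and "x \<in> carrier_vec n"
  shows "x \<bullet> ((c \<cdot>\<^sub>m A) *\<^sub>v x) = c * (x \<bullet> (A *\<^sub>v x))"
  using assms by (simp add: quadratic_form_sum[of _ n] sum_distrib_left mult.assoc mult.left_commute)

lemma quadratic_form_diff:
  fixes A B :: "real mat"
  assumes "A \<in> carrier_mat n n" and "B \<in> carrier_mat n n" and "x \<in> carrier_vec n"
  shows "x \<bullet> ((A - B) *\<^sub>v x) = x \<bullet> (A *\<^sub>v x) - x \<bullet> (B *\<^sub>v x)"
proof -
  have "x \<bullet> ((A - B) *\<^sub>v x) =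
      (\<Sum>i<n. \<Sum>j<n. x $ i * A $$ (i, j) * x $ j - x $ i * B $$ (i, j) * x $ j)"
    using assms by (subst quadratic_form_sum[of _ n]) (auto simp: algebra_simps intro!: sum.cong)
  then show ?thesis
    using assms by (simp add: quadratic_form_sum[of _ n] sum_subtractf)
qed

lemma scalar_prod_self_pos:
  fixes x :: "real vec"
  assumes "x \<in> carrier_vec n" and "x \<noteq> 0\<^sub>v n"
  shows "0 < x \<bullet> x"
proof -
  obtain i where "i < n" "x $ i \<noteq> 0"
    using assms by (metis eq_vecI carrier_vecD index_zero_vec)
  then show ?thesis
    unfolding scalar_prod_def using assms
    by (intro sum_pos2[of _ i]) (auto simp: zero_less_mult_iff linorder_neq_iff)
qed

lemma outer_prod_carrier [simp]:
  "u \<in> carrier_vec n \<Longrightarrow> w \<in> carrier_vec m \<Longrightarrow> outer_prod u w \<in> carrier_mat n m"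
  by (auto simp: outer_prod_def)

lemma mat_sum_carrier [simp]: "mat_sum n f I \<in> carrier_mat n n"
  by (simp add: mat_sum_def)

lemma quadratic_form_smult_outer_prod:
  fixes c :: real
  assumes "x \<in> carrier_vec n" and "u \<in> carrier_vec n"
  shows "x \<bullet> ((c \<cdot>\<^sub>m outer_prod u u) *\<^sub>v x) = c * (x \<bullet> u)\<^sup>2"
proof -
  have "x \<bullet> ((c \<cdot>\<^sub>m outer_prod u u) *\<^sub>v x) = (\<Sum>i<n. \<Sum>j<n. c * ((x $ i * u $ i) * (x $ j * u $ j)))"
    using assms by (subst quadratic_form_sum[of _ n])
      (auto simp: outer_prod_def algebra_simps intro!: sum.cong)
  also have "\<dots> = c * (x \<bullet> u)\<^sup>2"
    using assms by (simp add: scalar_prod_def atLeast0LessThan power2_eq_square sum_product)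
      (simp add: sum_distrib_left)
  finally show ?thesis .
qed

lemma quadratic_form_mat_sum:
  fixes f :: "'i \<Rightarrow> real mat"
  assumes x: "x \<in> carrier_vec n" and f: "\<And>l. l \<in> I \<Longrightarrow> f l \<in> carrier_mat n n"
  shows "x \<bullet> (mat_sum n f I *\<^sub>v x) = (\<Sum>l\<in>I. x \<bullet> (f l *\<^sub>v x))"
proof -
  have "x \<bullet> (mat_sum n f I *\<^sub>v x) = (\<Sum>i<n. \<Sum>j<n. \<Sum>l\<in>I. x $ i * f l $$ (i, j) * x $ j)"
    using x by (subst quadratic_form_sum[of _ n])
      (auto simp: mat_sum_def sum_distrib_left sum_distrib_right intro!: sum.cong)
  also have "\<dots> = (\<Sum>l\<in>I. \<Sum>i<n. \<Sum>j<n. x $ i * f l $$ (i, j) * x $ j)"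
    by (simp add: sum.swap[of _ I])
  also have "\<dots> = (\<Sum>l\<in>I. x \<bullet> (f l *\<^sub>v x))"
    using x f by (intro sum.cong refl quadratic_form_sum[symmetric]) auto
  finally show ?thesis .
qed

lemma symmetric_matI:
  assumes "A \<in> carrier_mat n n" and "\<And>i j. i < n \<Longrightarrow> j < n \<Longrightarrow> A $$ (i, j) = A $$ (j, i)"
  shows "symmetric_mat A"
  using assms unfolding symmetric_mat_def by (auto intro!: eq_matI)

lemma symmetric_matD:
  assumes "symmetric_mat A" and "A \<in> carrier_mat n n" and "i < n" and "j < n"
  shows "A $$ (i, j) = A $$ (j, i)"
proof -
  have "A $$ (i, j) = transpose_mat A $$ (i, j)"
    using assms(1) by (simp add: symmetric_mat_def)
  then show ?thesis using assms(2-) by simp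
qed

subsection \<open>Positive definite matrices\<close>

lemma positive_definite_det_nonzero:
  assumes "positive_definite A" and A: "A \<in> carrier_mat n n"
  shows "det A \<noteq> 0"
proof
  assume "det A = 0"
  then obtain x where x: "x \<in> carrier_vec n" "x \<noteq> 0\<^sub>v n" and "A *\<^sub>v x = 0\<^sub>v n"
    using det_0_iff_vec_prod_zero_field[OF A] by blast
  moreover have "x \<bullet> (A *\<^sub>v x) > 0"
    using assms x by (auto simp: positive_definite_def)
  ultimately show False by simp
qed

lemma positive_definite_det_pos:
  assumes pd: "positive_definite A" and A: "A \<in> carrier_mat n n"
  shows "0 < det A"
  \<comment> \<open>The segment from the identity to \<open>A\<close> consists of positive definite matrices, so \<open>det\<close> has no
    zero on it and keeps the sign it has at the identity.\<close>
proof (rule ccontr)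
  assume "\<not> 0 < det A"
  define B where "B t = mat n n (\<lambda>(i, j). (1 - t) * (if i = j then 1 else 0) + t * A $$ (i, j))"
    for t :: real
  have B: "B t \<in> carrier_mat n n" for t
    by (simp add: B_def)
  have "det (B t) = (\<Sum>p | p permutes {0..<n}. signof p *
      (\<Prod>i = 0..<n. (1 - t) * (if i = p i then 1 else 0) + t * A $$ (i, p i)))" for t
    unfolding det_def'[OF B] by (intro sum.cong refl arg_cong2[where f = "(*)"] prod.cong)
      (auto simp: B_def permutes_in_image[of _ "{0..<n}", simplified])
  then have "continuous_on {0..1} (\<lambda>t. det (B t))"
    by (simp only:) (intro continuous_intros)
  moreover have "det (B 0) = 1"
  proof -
    have "B 0 = 1\<^sub>m n" by (auto simp: B_def)
    then show ?thesis by simp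
  qed
  moreover have "det (B 1) \<le> 0"
  proof -
    have "B 1 = A" using A by (auto simp: B_def)
    then show ?thesis using \<open>\<not> 0 < det A\<close> by simp
  qed
  ultimately obtain t where t: "0 \<le> t" "t \<le> 1" and "det (B t) = 0"
    using IVT2'[of "\<lambda>t. det (B t)" 1 0 0] by auto
  moreover have "positive_definite (B t)"
    unfolding positive_definite_def
  proof (intro conjI ballI impI)
    have "symmetric_mat A"
      using pd by (simp add: positive_definite_def)
    then show "symmetric_mat (B t)"
      by (intro symmetric_matI[OF B]) (auto simp: B_def intro: symmetric_matD[OF _ A])
    fix x :: "real vec" assume "x \<in> carrier_vec (dim_row (B t))" "x \<noteq> 0\<^sub>v (dim_row (B t))"
    then have x: "x \<in> carrier_vec n" "x \<noteq> 0\<^sub>v n"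
      by (auto simp: B_def)
    have "0 < x \<bullet> x" "0 < x \<bullet> (A *\<^sub>v x)"
      using x pd A by (auto simp: positive_definite_def intro: scalar_prod_self_pos)
    \<comment> \<open>For \<open>t = 0\<close> the first summand is positive, otherwise the second
      is; the remaining one is nonnegative.\<close>
    then have "0 < (1 - t) * (x \<bullet> x) + t * (x \<bullet> (A *\<^sub>v x))"
      using t by (cases "t = 0") (auto intro: add_nonneg_pos)
    also have "\<dots> = x \<bullet> (B t *\<^sub>v x)"
    proof -
      have "x \<bullet> x = x \<bullet> (1\<^sub>m n *\<^sub>v x)"
        using x by simp
      also have "\<dots> = (\<Sum>i<n. \<Sum>j<n. x $ i * (if i = j then 1 else 0) * x $ j)"
        using x by (subst quadratic_form_sum[of _ n]) (auto intro!: sum.cong)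
      finally show ?thesis
        unfolding quadratic_form_sum[OF A x(1)] quadratic_form_sum[OF B x(1)]
        by (simp only: sum_distrib_left flip: sum.distrib)
          (auto simp: B_def algebra_simps intro!: sum.cong)
    qed
    finally show "0 < x \<bullet> (B t *\<^sub>v x)" .
  qed
  ultimately show False
    using positive_definite_det_nonzero[OF _ B] by blast
qed

section \<open>Inverses of nonsingular and of symmetric matrices\<close>

lemma mat_inv_inverts:
  assumes "A \<in> carrier_mat n n" and "det A \<noteq> 0"
  shows "mat_inv A \<in> carrier_mat n n" and "A * mat_inv A = 1\<^sub>m n" and "mat_inv A * A = 1\<^sub>m n"
proof -
  obtain B where "mat_inverse A = Some B"
    using mat_inverse(1)[OF assms(1)] det_non_zero_imp_unit[OF assms] by fastforce
  then show "mat_inv A \<in> carrier_mat n n" and "A * mat_inv A = 1\<^sub>m n" and "mat_inv A * A = 1\<^sub>m n"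
    using mat_inverse(2)[OF assms(1)] by (auto simp: mat_inv_def)
qed

lemma transpose_mat_inv:
  assumes A: "A \<in> carrier_mat n n" and "det A \<noteq> 0" and "transpose_mat A = A"
  shows "transpose_mat (mat_inv A) = mat_inv A"
proof -
  note inv = mat_inv_inverts[OF A assms(2)]
  \<comment> \<open>Transposing \<open>A * mat_inv A = 1\<close> yields a left inverse of
    \<open>A\<close>, which must agree with the right inverse \<open>mat_inv A\<close>.\<close>
  have left: "transpose_mat (mat_inv A) * A = 1\<^sub>m n"
    using arg_cong[OF inv(2), of transpose_mat] A inv(1) assms(3)
    by (simp add: transpose_mult[of _ n n _ n])
  have "transpose_mat (mat_inv A) = transpose_mat (mat_inv A) * (A * mat_inv A)"
    using inv by simp
  also have "\<dots> = (transpose_mat (mat_inv A) * A) * mat_inv A"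
    using A inv(1) by (intro assoc_mult_mat[symmetric]) auto
  also have "\<dots> = mat_inv A"
    using left inv(1) by simp
  finally show ?thesis .
qed

subsection \<open>Principal submatrices\<close>

lemma sampling_matrix_carrier [simp]:
  "finite \<C> \<Longrightarrow> sampling_matrix n \<C> \<in> carrier_mat n (card \<C>)"
  using mat_of_cols_carrier(1)[of n "map (unit_vec n) (sorted_list_of_set \<C>)"]
  by (simp add: sampling_matrix_def)

lemma sampling_matrix_dim [simp]:
  "dim_row (sampling_matrix n \<C>) = n" "finite \<C> \<Longrightarrow> dim_col (sampling_matrix n \<C>) = card \<C>"
  by (simp_all add: sampling_matrix_def)

lemma col_sampling_matrix:
  "finite \<C> \<Longrightarrow> j < card \<C> \<Longrightarrow>
    col (sampling_matrix n \<C>) j = unit_vec n (sorted_list_of_set \<C> ! j)"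
  by (simp add: sampling_matrix_def)

lemma nth_sorted_list_of_set_less:
  fixes \<C> :: "nat set"
  assumes "\<C> \<subseteq> {0..<n}" and "j < card \<C>"
  shows "sorted_list_of_set \<C> ! j < n"
  using assms nth_mem[of j "sorted_list_of_set \<C>"] finite_subset[OF assms(1) finite_atLeastLessThan]
  by auto

lemma transpose_sampling_matrix_mult_vec:
  assumes "\<C> \<subseteq> {0..<n}" and "x \<in> carrier_vec n"
  shows "transpose_mat (sampling_matrix n \<C>) *\<^sub>v x =
    vec (card \<C>) (\<lambda>j. x $ (sorted_list_of_set \<C> ! j))"
  using assms finite_subset[OF assms(1)] nth_sorted_list_of_set_less[OF assms(1)]
  by (intro eq_vecI) (auto simp: col_sampling_matrix)

text \<open>The columns are distinct unit vectors. The identity makes the sampling matrix injective,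
  as needed for positive definiteness of principal submatrices.\<close>

lemma transpose_sampling_matrix_mult:
  assumes C: "\<C> \<subseteq> {0..<n}"
  shows "transpose_mat (sampling_matrix n \<C>) * sampling_matrix n \<C> = 1\<^sub>m (card \<C>)"
proof (rule eq_matI)
  fix i j assume "i < dim_row (1\<^sub>m (card \<C>) :: real mat)" "j < dim_col (1\<^sub>m (card \<C>) :: real mat)"
  then show "(transpose_mat (sampling_matrix n \<C>) * sampling_matrix n \<C>) $$ (i, j) = 1\<^sub>m (card \<C>) $$ (i, j)"
    using finite_subset[OF C] nth_sorted_list_of_set_less[OF C]
      nth_eq_iff_index_eq[of "sorted_list_of_set \<C>" i j]
    by (auto simp: col_sampling_matrix)
qed (use finite_subset[OF C] in auto)

text \<open>Passes from the definition by matrix products to entries, listed in increasing order of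
  the indices in the subset.\<close>

lemma principal_submatrix_eq:
  assumes A: "A \<in> carrier_mat n n" and C: "\<C> \<subseteq> {0..<n}"
  shows "principal_submatrix A \<C> = mat (card \<C>) (card \<C>)
    (\<lambda>(i, j). A $$ (sorted_list_of_set \<C> ! i, sorted_list_of_set \<C> ! j))"
proof (rule eq_matI)
  let ?S = "sampling_matrix n \<C>" and ?s = "\<lambda>i. sorted_list_of_set \<C> ! i"
  have fin: "finite \<C>" using finite_subset[OF C] by simp
  have dim: "dim_row A = n" "dim_col A = n" using A by auto
  fix i j
  assume "i < dim_row (mat (card \<C>) (card \<C>) (\<lambda>(i, j). A $$ (?s i, ?s j)))"
    and "j < dim_col (mat (card \<C>) (card \<C>) (\<lambda>(i, j). A $$ (?s i, ?s j)))"
  then have ij: "i < card \<C>" "j < card \<C>" by auto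
  note s = nth_sorted_list_of_set_less[OF C ij(1)] nth_sorted_list_of_set_less[OF C ij(2)]
  have "(transpose_mat ?S * A * ?S) $$ (i, j) = row (transpose_mat ?S * A) i \<bullet> unit_vec n (?s j)"
    using ij fin dim by (simp add: col_sampling_matrix)
  also have "\<dots> = (transpose_mat ?S * A) $$ (i, ?s j)"
    using ij fin dim s by simp
  also have "\<dots> = unit_vec n (?s i) \<bullet> col A (?s j)"
    using ij fin dim s by (simp add: col_sampling_matrix)
  also have "\<dots> = A $$ (?s i, ?s j)"
    using A s dim by simp
  finally show "principal_submatrix A \<C> $$ (i, j) = mat (card \<C>) (card \<C>) (\<lambda>(i, j). A $$ (?s i, ?s j)) $$ (i, j)"
    using ij dim by (simp add: principal_submatrix_def)
qed (use A finite_subset[OF C] in \<open>auto simp: principal_submatrix_def\<close>)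

lemma principal_submatrix_carrier:
  "A \<in> carrier_mat n n \<Longrightarrow> \<C> \<subseteq> {0..<n} \<Longrightarrow> principal_submatrix A \<C> \<in> carrier_mat (card \<C>) (card \<C>)"
  by (simp add: principal_submatrix_eq)

text \<open>Compression by the sampling matrix sends \<open>outer_prod x x\<close> to
  \<open>outer_prod y y\<close>, so a rank-one update of the whole matrix is a rank-one update of
  each principal submatrix.\<close>

lemma principal_submatrix_add_outer_prod:
  assumes "A \<in> carrier_mat n n" and "\<C> \<subseteq> {0..<n}" and "x \<in> carrier_vec n"
    and "y = transpose_mat (sampling_matrix n \<C>) *\<^sub>v x"
  shows "principal_submatrix (A + outer_prod x x) \<C> = principal_submatrix A \<C> + outer_prod y y"
  using assms nth_sorted_list_of_set_less[OF assms(2)]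
  by (auto simp: principal_submatrix_eq[of _ n] transpose_sampling_matrix_mult_vec outer_prod_def
      intro!: eq_matI)

text \<open>The quadratic form of the submatrix at \<open>z\<close> is that of \<open>A\<close> at
  the vector \<open>z\<close> extended by zeros, which is nonzero because its restriction is
  \<open>z\<close> again.\<close>

lemma positive_definite_principal_submatrix:
  assumes pd: "positive_definite A" and A: "A \<in> carrier_mat n n" and C: "\<C> \<subseteq> {0..<n}"
  shows "positive_definite (principal_submatrix A \<C>)"
  unfolding positive_definite_def
proof (intro conjI ballI impI)
  let ?S = "sampling_matrix n \<C>"
  note P = principal_submatrix_carrier[OF A C]
  have fin: "finite \<C>" using finite_subset[OF C] by simp
  have S: "?S \<in> carrier_mat n (card \<C>)" using fin by simp
  have "symmetric_mat A"
    using pd by (simp add: positive_definite_def)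
  then show "symmetric_mat (principal_submatrix A \<C>)"
    by (intro symmetric_matI[OF P])
      (auto simp: principal_submatrix_eq[OF A C] nth_sorted_list_of_set_less[OF C] intro: symmetric_matD[OF _ A])
  fix z :: "real vec" assume "z \<in> carrier_vec (dim_row (principal_submatrix A \<C>))"
    and "z \<noteq> 0\<^sub>v (dim_row (principal_submatrix A \<C>))"
  then have z: "z \<in> carrier_vec (card \<C>)" "z \<noteq> 0\<^sub>v (card \<C>)"
    using P by auto
  have Sz: "?S *\<^sub>v z \<in> carrier_vec n"
    using S z by simp
  have "transpose_mat ?S *\<^sub>v (?S *\<^sub>v z) = z"
    using assoc_mult_mat_vec[of "transpose_mat ?S" "card \<C>" n ?S "card \<C>" z] S z
    by (simp add: transpose_sampling_matrix_mult[OF C])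
  moreover have "transpose_mat ?S *\<^sub>v 0\<^sub>v n = 0\<^sub>v (card \<C>)"
    using fin C by (auto simp: transpose_sampling_matrix_mult_vec nth_sorted_list_of_set_less)
  ultimately have "?S *\<^sub>v z \<noteq> 0\<^sub>v n"
    using z by metis
  then have "0 < (?S *\<^sub>v z) \<bullet> (A *\<^sub>v (?S *\<^sub>v z))"
    using pd A Sz by (auto simp: positive_definite_def)
  also have "\<dots> = z \<bullet> (transpose_mat ?S *\<^sub>v (A *\<^sub>v (?S *\<^sub>v z)))"
    using transpose_vec_mult_scalar[of "transpose_mat ?S" "card \<C>" n "A *\<^sub>v (?S *\<^sub>v z)" z] S A z
    by simp
  also have "transpose_mat ?S *\<^sub>v (A *\<^sub>v (?S *\<^sub>v z)) = principal_submatrix A \<C> *\<^sub>v z"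
    using S A z unfolding principal_submatrix_def
    by (simp add: assoc_mult_mat_vec[of _ "card \<C>" n _ "card \<C>"] assoc_mult_mat_vec[of _ "card \<C>" n A n])
  finally show "0 < z \<bullet> (principal_submatrix A \<C> *\<^sub>v z)" .
qed

subsection \<open>Spectral decompositions\<close>

text \<open>The coefficients \<open>c\<close> are free so that \<open>K\<close>, the identity,
  \<open>1 + s K\<close>, its inverse and the right-hand side of the theorem all belong to one
  family, on which computations are coefficientwise.\<close>

definition spectral_mat :: "nat \<Rightarrow> (nat \<Rightarrow> real vec) \<Rightarrow> (nat \<Rightarrow> real) \<Rightarrow> real mat" where
  "spectral_mat n v c = mat_sum n (\<lambda>l. c l \<cdot>\<^sub>m outer_prod (v l) (v l)) {1..n}"

lemma spectral_mat_carrier [simp]: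
  "spectral_mat n v c \<in> carrier_mat n n"
  "dim_row (spectral_mat n v c) = n" "dim_col (spectral_mat n v c) = n"
  by (simp_all add: spectral_mat_def mat_sum_def)

lemma orthonormal_family_carrier:
  "orthonormal_family n I v \<Longrightarrow> l \<in> I \<Longrightarrow> v l \<in> carrier_vec n"
  by (simp add: orthonormal_family_def)

lemma index_spectral_mat:
  assumes v: "orthonormal_family n {1..n} v" and "i < n" and "j < n"
  shows "spectral_mat n v c $$ (i, j) = (\<Sum>l\<in>{1..n}. c l * (v l $ i * v l $ j))"
proof -
  have "(c l \<cdot>\<^sub>m outer_prod (v l) (v l)) $$ (i, j) = c l * (v l $ i * v l $ j)" if "l \<in> {1..n}" for l
    using assms(2,3) orthonormal_family_carrier[OF v that] by (auto simp: outer_prod_def)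
  then show ?thesis
    using assms(2,3) by (simp add: spectral_mat_def mat_sum_def)
qed

text \<open>One orthogonal matrix serves all \<open>c\<close> at once: its columns are the vectors
  of the family. The shift by \<open>Suc\<close> arises because columns are counted from 0 and the
  family from 1.\<close>

lemma orthonormal_diagonalization:
  assumes v: "orthonormal_family n {1..n} v"
  obtains V where "V \<in> carrier_mat n n" "transpose_mat V * V = 1\<^sub>m n" "V * transpose_mat V = 1\<^sub>m n"
    and "\<And>c. spectral_mat n v c =
      V * mat n n (\<lambda>(i, j). if i = j then c (Suc i) else 0) * transpose_mat V"
proof
  define V where "V = mat n n (\<lambda>(i, j). v (Suc j) $ i)"
  note dim = orthonormal_family_carrier[OF v]
  show V: "V \<in> carrier_mat n n"
    by (simp add: V_def)
  have col: "col V j = v (Suc j)" if "j < n" for j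
    using that dim[of "Suc j"] by (intro eq_vecI) (simp_all add: V_def)
  show VV: "transpose_mat V * V = 1\<^sub>m n"
  proof (rule eq_matI)
    fix i j assume "i < dim_row (1\<^sub>m n :: real mat)" "j < dim_col (1\<^sub>m n :: real mat)"
    then show "(transpose_mat V * V) $$ (i, j) = 1\<^sub>m n $$ (i, j)"
      using V v by (simp add: col orthonormal_family_def)
  qed (use V in auto)
  then show "V * transpose_mat V = 1\<^sub>m n"
    using mat_mult_left_right_inverse[of "transpose_mat V" n V] V by simp
  fix c :: "nat \<Rightarrow> real"
  let ?D = "mat n n (\<lambda>(i, j). if i = j then c (Suc i) else 0)"
  have VD: "V * ?D = mat n n (\<lambda>(i, j). v (Suc j) $ i * c (Suc j))"
    using V by (intro eq_matI) (auto simp: scalar_prod_def V_def mult_delta_right)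
  show "spectral_mat n v c = V * ?D * transpose_mat V"
  proof (rule eq_matI)
    fix i j assume "i < dim_row (V * ?D * transpose_mat V)" "j < dim_col (V * ?D * transpose_mat V)"
    then have ij: "i < n" "j < n" using V by auto
    show "spectral_mat n v c $$ (i, j) = (V * ?D * transpose_mat V) $$ (i, j)"
      unfolding index_spectral_mat[OF v ij] VD One_nat_def sum.atLeast1_atMost_eq using ij V
      by (auto simp: scalar_prod_def V_def atLeast0LessThan intro!: sum.cong)
  qed (use V in auto)
qed

lemma det_spectral_mat:
  assumes v: "orthonormal_family n {1..n} v"
  shows "det (spectral_mat n v c) = (\<Prod>l\<in>{1..n}. c l)"
proof -
  obtain V where V: "V \<in> carrier_mat n n" "transpose_mat V * V = 1\<^sub>m n" "V * transpose_mat V = 1\<^sub>m n"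
    and eq: "\<And>c. spectral_mat n v c =
      V * mat n n (\<lambda>(i, j). if i = j then c (Suc i) else 0) * transpose_mat V"
    by (rule orthonormal_diagonalization[OF v]) (rule that)
  let ?D = "mat n n (\<lambda>(i, j). if i = j then c (Suc i) else 0)"
  have "det ?D = (\<Prod>i<n. c (Suc i))"
    by (subst det_upper_triangular[of _ n]) (auto simp: prod_list_diag_prod atLeast0LessThan)
  also have "\<dots> = (\<Prod>l\<in>{1..n}. c l)"
    by (simp add: prod.atLeast1_atMost_eq)
  finally have D: "det ?D = (\<Prod>l\<in>{1..n}. c l)" .
  have "det (transpose_mat V) * det V = 1"
    using V det_mult[of "transpose_mat V" n V] by simp
  moreover have "det (spectral_mat n v c) = det V * det ?D * det (transpose_mat V)"
    unfolding eq using V(1) det_mult[of V n ?D] det_mult[of "V * ?D" n "transpose_mat V"] by simp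
  ultimately show ?thesis
    by (simp add: D ac_simps)
qed

text \<open>Completeness of the basis: an orthonormal family of \<open>n\<close> vectors in
  dimension \<open>n\<close> resolves the identity.\<close>

lemma spectral_mat_one:
  assumes "orthonormal_family n {1..n} v"
  shows "spectral_mat n v (\<lambda>_. 1) = 1\<^sub>m n"
proof -
  obtain V where V: "V \<in> carrier_mat n n" "transpose_mat V * V = 1\<^sub>m n" "V * transpose_mat V = 1\<^sub>m n"
    and eq: "\<And>c. spectral_mat n v c =
      V * mat n n (\<lambda>(i, j). if i = j then c (Suc i) else 0) * transpose_mat V"
    by (rule orthonormal_diagonalization[OF assms]) (rule that)
  have "mat n n (\<lambda>(i, j). if i = j then 1 else 0) = (1\<^sub>m n :: real mat)"
    by auto
  then show ?thesis
    using V by (simp add: eq)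
qed

text \<open>The inner factor \<open>transpose_mat V * V\<close> cancels. This provides explicit
  inverses in the eigenbasis.\<close>

lemma spectral_mat_mult:
  assumes "orthonormal_family n {1..n} v"
  shows "spectral_mat n v c * spectral_mat n v d = spectral_mat n v (\<lambda>l. c l * d l)"
proof -
  obtain V where V: "V \<in> carrier_mat n n" "transpose_mat V * V = 1\<^sub>m n" "V * transpose_mat V = 1\<^sub>m n"
    and eq: "\<And>c. spectral_mat n v c =
      V * mat n n (\<lambda>(i, j). if i = j then c (Suc i) else 0) * transpose_mat V"
    by (rule orthonormal_diagonalization[OF assms]) (rule that)
  let ?D = "\<lambda>c. mat n n (\<lambda>(i, j). if i = j then c (Suc i) else 0) :: real mat"
  have D: "?D c * ?D d = ?D (\<lambda>l. c l * d l)"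
    by (intro eq_matI) (auto simp: scalar_prod_def mult_delta_left)
  have Dc: "?D c \<in> carrier_mat n n" for c by simp
  have Vt: "transpose_mat V \<in> carrier_mat n n" using V by simp
  note assoc = assoc_mult_mat[of _ n n _ n _ n]
  have "(V * ?D c * transpose_mat V) * (V * ?D d * transpose_mat V) =
    (V * ?D c * transpose_mat V) * (V * (?D d * transpose_mat V))"
    using V(1) Vt Dc by (subst (2) assoc) auto
  also have "\<dots> = V * ?D c * (transpose_mat V * (V * (?D d * transpose_mat V)))"
    using V(1) Vt Dc mult_carrier_mat by (intro assoc) auto
  also have "transpose_mat V * (V * (?D d * transpose_mat V)) =
    transpose_mat V * V * (?D d * transpose_mat V)"
    using V(1) Vt Dc by (intro assoc[symmetric]) auto
  also have "\<dots> = ?D d * transpose_mat V"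
    unfolding V(2) using Vt by (intro left_mult_one_mat[of _ n n]) auto
  also have "V * ?D c * (?D d * transpose_mat V) = V * ?D c * ?D d * transpose_mat V"
    using V(1) Vt Dc by (intro assoc[symmetric]) auto
  also have "V * ?D c * ?D d = V * (?D c * ?D d)"
    using V(1) Dc by (intro assoc) auto
  finally show ?thesis
    by (simp only: eq D)
qed

lemma quadratic_form_spectral_mat:
  assumes v: "orthonormal_family n {1..n} v" and x: "x \<in> carrier_vec n"
  shows "x \<bullet> (spectral_mat n v c *\<^sub>v x) = (\<Sum>l\<in>{1..n}. c l * (x \<bullet> v l)\<^sup>2)"
  using orthonormal_family_carrier[OF v] x
  unfolding spectral_mat_def by (subst quadratic_form_mat_sum) (auto simp: quadratic_form_smult_outer_prod)

lemma one_smult_mat: "1 \<cdot>\<^sub>m A = A" for A :: "'a :: monoid_mult mat"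
  by auto

text \<open>Covers both \<open>1 + s K\<close>, for sums of principal minors, and
  \<open>t - K\<close>, for the characteristic polynomial.\<close>

lemma spectral_mat_affine:
  assumes v: "orthonormal_family n {1..n} v"
  shows "a \<cdot>\<^sub>m 1\<^sub>m n + b \<cdot>\<^sub>m spectral_mat n v c = spectral_mat n v (\<lambda>l. a + b * c l)"
  unfolding spectral_mat_one[OF v, symmetric]
proof (rule eq_matI)
  let ?R = "spectral_mat n v (\<lambda>l. a + b * c l)"
  fix i j assume "i < dim_row ?R" "j < dim_col ?R"
  then have ij: "i < n" "j < n" by auto
  then have "(a \<cdot>\<^sub>m spectral_mat n v (\<lambda>_. 1) + b \<cdot>\<^sub>m spectral_mat n v c) $$ (i, j) =
    a * spectral_mat n v (\<lambda>_. 1) $$ (i, j) + b * spectral_mat n v c $$ (i, j)"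
    by simp
  also have "\<dots> = ?R $$ (i, j)"
    unfolding index_spectral_mat[OF v ij]
    by (simp add: sum_distrib_left algebra_simps flip: sum.distrib)
  finally show "(a \<cdot>\<^sub>m spectral_mat n v (\<lambda>_. 1) + b \<cdot>\<^sub>m spectral_mat n v c) $$ (i, j) = ?R $$ (i, j)" .
qed auto

section \<open>Eigenvalues of a matrix given in an orthonormal eigenbasis\<close>

lemma char_poly_spectral_mat:
  assumes v: "orthonormal_family n {1..n} v"
  shows "char_poly (spectral_mat n v c) = (\<Prod>l\<in>{1..n}. [:- c l, 1:])"
proof -
  have "poly (char_poly (spectral_mat n v c)) t = poly (\<Prod>l\<in>{1..n}. [:- c l, 1:]) t" for t
  proof -
    have "- (char_matrix (spectral_mat n v c) t) = t \<cdot>\<^sub>m 1\<^sub>m n + (-1) \<cdot>\<^sub>m spectral_mat n v c"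
      by (intro eq_matI) (auto simp: char_matrix_def)
    then have "poly (char_poly (spectral_mat n v c)) t = (\<Prod>l\<in>{1..n}. t + (-1) * c l)"
      unfolding char_poly_matrix[OF spectral_mat_carrier(1)] spectral_mat_affine[OF v]
      by (simp add: det_spectral_mat[OF v])
    then show ?thesis by (simp add: poly_prod)
  qed
  then show ?thesis by (simp add: poly_eq_poly_eq_iff[symmetric] fun_eq_iff)
qed

lemma sum_singleton_mset: "finite A \<Longrightarrow> (\<Sum>x\<in>A. {#f x#}) = image_mset f (mset_set A)"
  by (induction A rule: finite_induct) auto

text \<open>The eigenvalue list and the family \<open>c\<close> agree as multisets, hence have the
  same generating product; comparing coefficients passes from list positions to the indices of
  \<open>c\<close>.\<close>

lemma elem_sym_spectral_mat:
  assumes v: "orthonormal_family n {1..n} v"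
  shows "elem_sym k (spectral_mat n v c) = esym k {1..n} c"
proof -
  define xs where "xs = eigenvalue_list (spectral_mat n v c)"
  have "proots (\<Prod>l\<in>{1..n}. [:- c l, 1:]) = (\<Sum>l\<in>{1..n}. {#c l#})"
    by (subst proots_prod) auto
  also have "\<dots> = image_mset c (mset_set {1..n})"
    by (rule sum_singleton_mset) simp
  finally have mset: "mset xs = image_mset c (mset_set {1..n})"
    by (simp add: xs_def eigenvalue_list_def char_poly_spectral_mat[OF v])
  have "(\<Prod>i\<in>{0..<length xs}. [:1, xs ! i:]) = (\<Prod>x\<leftarrow>xs. [:1, x:])"
    by (simp add: prod.list_conv_set_nth)
  also have "\<dots> = prod_mset (image_mset (\<lambda>x. [:1, x:]) (mset xs))"
    by (simp flip: prod_mset_prod_list mset_map)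
  also have "\<dots> = (\<Prod>l\<in>{1..n}. [:1, c l:])"
    by (simp add: mset image_mset.compositionality comp_def prod_unfold_prod_mset)
  finally have "(\<Prod>i\<in>{0..<length xs}. [:1, xs ! i:]) = (\<Prod>l\<in>{1..n}. [:1, c l:])" .
  then have "esym k {0..<length xs} (nth xs) = esym k {1..n} c"
    by (metis coeff_prod_linear finite_atLeastAtMost finite_atLeastLessThan)
  then show ?thesis
    by (simp add: elem_sym_def Let_def esym_def xs_def)
qed

subsection \<open>Sums of principal minors\<close>

lemma det_one_add_smult_principal_minors:
  assumes A: "A \<in> carrier_mat n n"
  shows "det (1\<^sub>m n + s \<cdot>\<^sub>m A) =
    (\<Sum>\<C>\<in>Pow {0..<n}. s ^ card \<C> * det (principal_submatrix A \<C>))"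
  unfolding det_one_add_smult[OF A]
proof (intro sum.cong refl arg_cong2[where f = "(*)"])
  fix \<C> assume "\<C> \<in> Pow {0..<n}"
  then have C: "\<C> \<subseteq> {0..<n}" by simp
  then have "finite \<C>" using finite_subset by blast
  then have "bij_betw (nth (sorted_list_of_set \<C>)) {0..<card \<C>} \<C>"
    by (intro bij_betw_nth) (auto simp: atLeast0LessThan)
  from det_reindex[OF this, of A]
  show "(\<Sum>p | p permutes \<C>. signof p * (\<Prod>i\<in>\<C>. A $$ (i, p i))) = det (principal_submatrix A \<C>)"
    by (simp add: principal_submatrix_eq[OF A C])
qed

text \<open>Two real polynomials that agree on a half-line are equal. Restricting to nonnegative
  \<open>s\<close> keeps \<open>1 + s * c l\<close> nonzero in the application to a rank-one
  update.\<close>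

lemma sum_principal_minors_eq_coeff:
  assumes A: "A \<in> carrier_mat n n"
    and q: "\<And>s. 0 \<le> s \<Longrightarrow> det (1\<^sub>m n + s \<cdot>\<^sub>m A) = poly q s"
  shows "(\<Sum>\<C> | \<C> \<subseteq> {0..<n} \<and> card \<C> = k. det (principal_submatrix A \<C>)) = coeff q k"
proof -
  define p where "p = (\<Sum>\<C>\<in>Pow {0..<n}. monom (det (principal_submatrix A \<C>)) (card \<C>))"
  have "poly p s = poly q s" if "0 \<le> s" for s
    using q[OF that] by (simp add: p_def poly_sum poly_monom det_one_add_smult_principal_minors[OF A] mult.commute)
  then have "{0..} \<subseteq> {s. poly (p - q) s = 0}"
    by auto
  then have "p = q"
    using poly_roots_finite[of "p - q"] infinite_Ici[of "0 :: real"] finite_subset by auto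
  moreover have "coeff p k = (\<Sum>\<C> | \<C> \<subseteq> {0..<n} \<and> card \<C> = k. det (principal_submatrix A \<C>))"
    by (simp add: p_def coeff_sum sum.If_cases Int_def)
  ultimately show ?thesis by simp
qed

text \<open>In the eigenbasis \<open>det (1 + s K)\<close> is the generating product of the
  eigenvalues. For the process this says that the weights sum to 1.\<close>

lemma sum_principal_minors_spectral_mat:
  assumes v: "orthonormal_family n {1..n} v"
  shows "(\<Sum>\<C> | \<C> \<subseteq> {0..<n} \<and> card \<C> = k. det (principal_submatrix (spectral_mat n v c) \<C>)) =
    esym k {1..n} c"
proof -
  have "1\<^sub>m n + s \<cdot>\<^sub>m spectral_mat n v c = spectral_mat n v (\<lambda>l. 1 + s * c l)" for s
    using spectral_mat_affine[OF v, of 1 s c] by (simp only: one_smult_mat)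
  then have "det (1\<^sub>m n + s \<cdot>\<^sub>m spectral_mat n v c) = poly (\<Prod>l\<in>{1..n}. [:1, c l:]) s" for s
    by (simp only: det_spectral_mat[OF v]) (simp add: poly_prod)
  then show ?thesis
    by (subst sum_principal_minors_eq_coeff) (auto simp: coeff_prod_linear)
qed

text \<open>The matrix determinant lemma gives the product of all \<open>1 + s * c l\<close> times
  \<open>1 + s\<close> times a sum of \<open>(x \<bullet> v l)\<^sup>2 / (1 + s * c l)\<close>; each
  denominator cancels one factor of the product.\<close>

lemma sum_principal_minors_add_outer_prod:
  assumes v: "orthonormal_family n {1..n} v" and x: "x \<in> carrier_vec n"
    and c: "\<And>l. l \<in> {1..n} \<Longrightarrow> 0 < c l"
  shows "(\<Sum>\<C> | \<C> \<subseteq> {0..<n} \<and> card \<C> = Suc k.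
      det (principal_submatrix (spectral_mat n v c + outer_prod x x) \<C>)) =
    esym (Suc k) {1..n} c + (\<Sum>l\<in>{1..n}. (x \<bullet> v l)\<^sup>2 * esym k ({1..n} - {l}) c)"
proof -
  let ?I = "{1..n}"
  \<comment> \<open>\<open>pCons 0\<close> is multiplication by the variable, so degree
    \<open>Suc k\<close> of the second summand reads off degree \<open>k\<close> in the coefficients
    other than \<open>c l\<close>.\<close>
  let ?q = "(\<Prod>l\<in>?I. [:1, c l:]) +
    pCons 0 (\<Sum>l\<in>?I. Polynomial.smult ((x \<bullet> v l)\<^sup>2) (\<Prod>m\<in>?I - {l}. [:1, c m:]))"
  have "det (1\<^sub>m n + s \<cdot>\<^sub>m (spectral_mat n v c + outer_prod x x)) = poly ?q s" if s: "0 \<le> s" for s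
  proof -
    let ?d = "\<lambda>l. 1 + s * c l"
    have d: "?d l \<noteq> 0" if "l \<in> ?I" for l
      using s c[OF that] by (simp add: add_nonneg_eq_0_iff)
    let ?A = "spectral_mat n v ?d" and ?B = "spectral_mat n v (\<lambda>l. 1 / ?d l)"
    have "spectral_mat n v (\<lambda>l. ?d l * (1 / ?d l)) = spectral_mat n v (\<lambda>_. 1)"
      unfolding spectral_mat_def mat_sum_def
      using d by (intro arg_cong[where f = "mat n n"] ext sum.cong refl) simp
    then have inv: "?A * ?B = 1\<^sub>m n"
      by (simp only: spectral_mat_mult[OF v] spectral_mat_one[OF v])
    have "1\<^sub>m n + s \<cdot>\<^sub>m (spectral_mat n v c + outer_prod x x) =
        (1 \<cdot>\<^sub>m 1\<^sub>m n + s \<cdot>\<^sub>m spectral_mat n v c) + outer_prod (s \<cdot>\<^sub>v x) x"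
      using x by (intro eq_matI) (auto simp: outer_prod_def algebra_simps)
    then have "det (1\<^sub>m n + s \<cdot>\<^sub>m (spectral_mat n v c + outer_prod x x)) =
        det ?A * (1 + x \<bullet> (?B *\<^sub>v (s \<cdot>\<^sub>v x)))"
      unfolding spectral_mat_affine[OF v] using x inv by (simp add: det_add_outer_prod[of _ n ?B])
    also have "x \<bullet> (?B *\<^sub>v (s \<cdot>\<^sub>v x)) = s * (x \<bullet> (?B *\<^sub>v x))"
      using x by (simp add: mult_mat_vec[of _ n n] )
    also have "det ?A * (1 + s * (x \<bullet> (?B *\<^sub>v x))) =
        (\<Prod>l\<in>?I. ?d l) + s * (\<Sum>l\<in>?I. (x \<bullet> v l)\<^sup>2 * ((\<Prod>l\<in>?I. ?d l) / ?d l))"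
      unfolding det_spectral_mat[OF v] quadratic_form_spectral_mat[OF v x]
      by (simp add: algebra_simps sum_distrib_left)
    also have "(\<Sum>l\<in>?I. (x \<bullet> v l)\<^sup>2 * ((\<Prod>l\<in>?I. ?d l) / ?d l)) =
        (\<Sum>l\<in>?I. (x \<bullet> v l)\<^sup>2 * (\<Prod>m\<in>?I - {l}. ?d m))"
      using d by (intro sum.cong refl) (simp add: prod.remove)
    also have "(\<Prod>l\<in>?I. ?d l) + s * \<dots> = poly ?q s"
      by (simp add: poly_prod poly_sum)
    finally show ?thesis .
  qed
  then have "(\<Sum>\<C> | \<C> \<subseteq> {0..<n} \<and> card \<C> = Suc k.
      det (principal_submatrix (spectral_mat n v c + outer_prod x x) \<C>)) = coeff ?q (Suc k)"
    using x by (intro sum_principal_minors_eq_coeff) auto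
  also have "\<dots> = esym (Suc k) ?I c + (\<Sum>l\<in>?I. (x \<bullet> v l)\<^sup>2 * esym k (?I - {l}) c)"
    by (simp add: coeff_prod_linear coeff_sum)
  finally show ?thesis .
qed

subsection \<open>The determinantal point process\<close>

text \<open>\<open>embed_pmf\<close> returns the given weights once they are nonnegative with total
  mass 1. Nonnegativity holds because principal minors of a positive definite matrix are positive,
  and \<open>sum\<close> and \<open>pos\<close> yield the total mass.\<close>

lemma pmf_kDPP:
  assumes pd: "positive_definite K" and K: "K \<in> carrier_mat n n"
    and sum: "(\<Sum>\<C> | \<C> \<subseteq> {0..<n} \<and> card \<C> = k. det (principal_submatrix K \<C>)) = elem_sym k K"
    and pos: "0 < elem_sym k K"
  shows "pmf (kDPP k K) \<C> = (if \<C> \<subseteq> {0..<n} \<and> card \<C> = k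
    then det (principal_submatrix K \<C>) / elem_sym k K else 0)"
proof -
  let ?w = "\<lambda>\<C>. if \<C> \<subseteq> {0..<n} \<and> card \<C> = k
    then det (principal_submatrix K \<C>) / elem_sym k K else 0"
  let ?F = "{\<C>. \<C> \<subseteq> {0..<n} \<and> card \<C> = k}"
  have nonneg: "0 \<le> ?w \<C>" for \<C>
    using pos positive_definite_det_pos[OF positive_definite_principal_submatrix[OF pd K]
        principal_submatrix_carrier[OF K]]
    by (auto intro: less_imp_le)
  have "(\<integral>\<^sup>+\<C>. ennreal (?w \<C>) \<partial>count_space UNIV) = (\<Sum>\<C>\<in>?F. ennreal (?w \<C>))"
    by (rule nn_integral_count_space') auto
  also have "\<dots> = ennreal (\<Sum>\<C>\<in>?F. ?w \<C>)"
    using nonneg by (rule sum_ennreal)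
  also have "(\<Sum>\<C>\<in>?F. ?w \<C>) = 1"
    using sum pos by (simp flip: sum_divide_distrib)
  finally have "pmf (embed_pmf ?w) \<C> = ?w \<C>"
    using nonneg by (intro pmf_embed_pmf) auto
  then show ?thesis
    using K by (simp add: kDPP_def)
qed

lemma expectation_mat_finite_support:
  assumes "finite F" and "\<And>\<omega>. \<omega> \<notin> F \<Longrightarrow> pmf p \<omega> = 0"
    and X: "\<And>\<omega>. \<omega> \<in> F \<Longrightarrow> X \<omega> \<in> carrier_mat n n"
  shows "expectation_mat n p X = mat_sum n (\<lambda>\<omega>. pmf p \<omega> \<cdot>\<^sub>m X \<omega>) F"
proof (rule eq_matI)
  fix i j
  assume "i < dim_row (mat_sum n (\<lambda>\<omega>. pmf p \<omega> \<cdot>\<^sub>m X \<omega>) F)"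
    and "j < dim_col (mat_sum n (\<lambda>\<omega>. pmf p \<omega> \<cdot>\<^sub>m X \<omega>) F)"
  then have ij: "i < n" "j < n" by (auto simp: mat_sum_def)
  have "measure_pmf.expectation p (\<lambda>\<omega>. X \<omega> $$ (i, j)) = (\<Sum>\<omega>\<in>F. X \<omega> $$ (i, j) * pmf p \<omega>)"
    using assms(1,2) by (intro integral_measure_pmf_real) (auto simp: set_pmf_iff)
  also have "\<dots> = (\<Sum>\<omega>\<in>F. (pmf p \<omega> \<cdot>\<^sub>m X \<omega>) $$ (i, j))"
  proof (intro sum.cong refl)
    fix \<omega> assume "\<omega> \<in> F"
    then show "X \<omega> $$ (i, j) * pmf p \<omega> = (pmf p \<omega> \<cdot>\<^sub>m X \<omega>) $$ (i, j)"
      using X[of \<omega>] ij by simp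
  qed
  finally show "expectation_mat n p X $$ (i, j) = mat_sum n (\<lambda>\<omega>. pmf p \<omega> \<cdot>\<^sub>m X \<omega>) F $$ (i, j)"
    using ij by (simp add: expectation_mat_def mat_sum_def)
qed (auto simp: expectation_mat_def mat_sum_def)

lemma transpose_mat_smult: "transpose_mat (c \<cdot>\<^sub>m A) = c \<cdot>\<^sub>m transpose_mat A"
  by auto

lemma symmetric_mat_smult: "symmetric_mat A \<Longrightarrow> symmetric_mat (c \<cdot>\<^sub>m A)"
  unfolding symmetric_mat_def by (metis square_mat.simps index_smult_mat(2,3) transpose_mat_smult)

lemma symmetric_mat_mat_sum:
  assumes "\<And>l. l \<in> I \<Longrightarrow> symmetric_mat (f l)" and "\<And>l. l \<in> I \<Longrightarrow> f l \<in> carrier_mat n n"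
  shows "symmetric_mat (mat_sum n f I)"
  by (intro symmetric_matI[OF mat_sum_carrier])
    (auto simp: mat_sum_def intro!: sum.cong intro: symmetric_matD assms)

text \<open>With \<open>y\<close> the restriction of \<open>x\<close>, the quadratic form of
  \<open>X\<close> at \<open>x\<close> is that of the inverted submatrix at \<open>y\<close>, which
  the matrix determinant lemma expresses by determinants. Multiplying by the minor prepares for the
  weights of the process.\<close>

lemma sampled_inverse:
  assumes pd: "positive_definite K" and K: "K \<in> carrier_mat n n" and C: "\<C> \<subseteq> {0..<n}"
  defines "X \<equiv> sampling_matrix n \<C> * mat_inv (principal_submatrix K \<C>)
    * transpose_mat (sampling_matrix n \<C>)"
  shows "X \<in> carrier_mat n n" and "symmetric_mat X"
    and "x \<in> carrier_vec n \<Longrightarrow> det (principal_submatrix K \<C>) * (x \<bullet> (X *\<^sub>v x)) =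
      det (principal_submatrix (K + outer_prod x x) \<C>) - det (principal_submatrix K \<C>)"
proof -
  let ?P = "principal_submatrix K \<C>" and ?S = "sampling_matrix n \<C>" and ?k = "card \<C>"
  have S: "?S \<in> carrier_mat n ?k"
    using finite_subset[OF C] by simp
  note P = principal_submatrix_carrier[OF K C]
    and pdP = positive_definite_principal_submatrix[OF pd K C]
  note inv = mat_inv_inverts[OF P positive_definite_det_nonzero[OF pdP P]]
  have symP: "transpose_mat (mat_inv ?P) = mat_inv ?P"
    using pdP transpose_mat_inv[OF P positive_definite_det_nonzero[OF pdP P]]
    by (simp add: positive_definite_def symmetric_mat_def)
  show X: "X \<in> carrier_mat n n"
    using S inv by (simp add: X_def)
  have "transpose_mat X = ?S * (mat_inv ?P * transpose_mat ?S)"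
    using S inv unfolding X_def
    by (subst transpose_mult[of _ n ?k _ n], simp, simp, subst transpose_mult[of _ n ?k _ ?k])
      (auto simp: symP)
  also have "\<dots> = X"
    using S inv(1) unfolding X_def by (intro assoc_mult_mat[symmetric]) auto
  finally show "symmetric_mat X"
    using X by (simp add: symmetric_mat_def)
  assume x: "x \<in> carrier_vec n"
  define y where "y = transpose_mat ?S *\<^sub>v x"
  have y: "y \<in> carrier_vec ?k"
    using S x by (simp add: y_def)
  have "X *\<^sub>v x = ?S *\<^sub>v (mat_inv ?P *\<^sub>v y)"
    using S inv(1) x unfolding X_def y_def
    by (simp add: assoc_mult_mat_vec[of _ n ?k _ n] assoc_mult_mat_vec[of _ n ?k _ ?k])
  then have "x \<bullet> (X *\<^sub>v x) = y \<bullet> (mat_inv ?P *\<^sub>v y)"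
    using transpose_vec_mult_scalar[OF S, of "mat_inv ?P *\<^sub>v y" x] inv(1) y x
    by (simp add: y_def)
  moreover have "det (principal_submatrix (K + outer_prod x x) \<C>) =
      det ?P * (1 + y \<bullet> (mat_inv ?P *\<^sub>v y))"
    using principal_submatrix_add_outer_prod[OF K C x y_def] det_add_outer_prod[OF P inv(1,2) y y]
    by simp
  ultimately show "det ?P * (x \<bullet> (X *\<^sub>v x)) =
      det (principal_submatrix (K + outer_prod x x) \<C>) - det ?P"
    by (simp add: algebra_simps)
qed

section \<open>Comparison of both sides in the eigenbasis\<close>

theorem proposition1:
  fixes K :: "real mat" and n k :: nat
    and lam :: "nat \<Rightarrow> real" and v :: "nat \<Rightarrow> real vec" and \<alpha> :: real
  assumes "K \<in> carrier_mat n n"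
    and "positive_definite K"
    and "orthonormal_family n {1..n} v"
    and "K = mat_sum n (\<lambda>l. lam l \<cdot>\<^sub>m outer_prod (v l) (v l)) {1..n}"
    and "antimono_on {1..n} lam"
    and "1 \<le> k" and "k \<le> n"
    and "\<alpha> = (\<Sum>i = k..n. lam i)"
  shows "expectation_mat n (kDPP k K)
           (\<lambda>\<C>. sampling_matrix n \<C> * mat_inv (principal_submatrix K \<C>)
                  * transpose_mat (sampling_matrix n \<C>))
         \<succeq>\<^sub>L mat_sum n (\<lambda>l. (1 / (lam l + \<alpha>)) \<cdot>\<^sub>m outer_prod (v l) (v l)) {1..n}"
proof -
  note K = assms(1) and pd = assms(2) and v = assms(3)
  have spectral: "K = spectral_mat n v lam"
    using assms(4) unfolding spectral_mat_def .
  note vc = orthonormal_family_carrier[OF v]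
  obtain m where k: "k = Suc m"
    using assms(6) by (cases k) auto
  let ?F = "{\<C>. \<C> \<subseteq> {0..<n} \<and> card \<C> = k}"
  let ?X = "\<lambda>\<C>. sampling_matrix n \<C> * mat_inv (principal_submatrix K \<C>)
    * transpose_mat (sampling_matrix n \<C>)"
  let ?e = "elem_sym k K" and ?a = "\<lambda>l. esym m ({1..n} - {l}) lam"
  let ?p = "kDPP k K"
  let ?E = "expectation_mat n ?p ?X" and ?R = "spectral_mat n v (\<lambda>l. 1 / (lam l + \<alpha>))"
  \<comment> \<open>The quadratic form of \<open>K\<close> at the unit vector \<open>v l\<close> is
    \<open>lam l\<close>.\<close>
  have lam: "0 < lam l" if l: "l \<in> {1..n}" for l
  proof -
    have "v l \<bullet> (K *\<^sub>v v l) = (\<Sum>m\<in>{1..n}. lam m * (v l \<bullet> v m)\<^sup>2)"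
      unfolding spectral using vc[OF l] by (rule quadratic_form_spectral_mat[OF v])
    also have "\<dots> = (\<Sum>m\<in>{1..n}. if m = l then lam l else 0)"
      using l v by (intro sum.cong refl) (auto simp: orthonormal_family_def)
    also have "\<dots> = lam l"
      using l by simp
    finally have "v l \<bullet> (K *\<^sub>v v l) = lam l" .
    moreover have "v l \<noteq> 0\<^sub>v n"
    proof
      assume "v l = 0\<^sub>v n"
      then have "v l \<bullet> v l = 0" by simp
      then show False using v l by (simp add: orthonormal_family_def)
    qed
    ultimately show ?thesis
      using pd vc[OF l] K by (auto simp: positive_definite_def)
  qed
  have e: "?e = esym k {1..n} lam"
    unfolding spectral by (rule elem_sym_spectral_mat[OF v])
  have e_pos: "0 < ?e"
    unfolding e using lam assms(7) by (intro esym_pos) auto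
  have minors: "(\<Sum>\<C>\<in>?F. det (principal_submatrix K \<C>)) = ?e"
    unfolding e unfolding spectral by (rule sum_principal_minors_spectral_mat[OF v])
  note pmf = pmf_kDPP[OF pd K minors e_pos]
  have X: "?X \<C> \<in> carrier_mat n n" "symmetric_mat (?X \<C>)" if "\<C> \<in> ?F" for \<C>
    using sampled_inverse(1,2)[OF pd K, of \<C>] that by auto
  have E: "?E = mat_sum n (\<lambda>\<C>. pmf ?p \<C> \<cdot>\<^sub>m ?X \<C>) ?F"
    using X(1) by (intro expectation_mat_finite_support) (auto simp: pmf)
  have quadratic_E: "x \<bullet> (?E *\<^sub>v x) = (\<Sum>l\<in>{1..n}. ?a l / ?e * (x \<bullet> v l)\<^sup>2)"
    if x: "x \<in> carrier_vec n" for x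
  proof -
    have "x \<bullet> (?E *\<^sub>v x) = (\<Sum>\<C>\<in>?F. x \<bullet> ((pmf ?p \<C> \<cdot>\<^sub>m ?X \<C>) *\<^sub>v x))"
      unfolding E by (rule quadratic_form_mat_sum[OF x]) (rule smult_carrier_mat, rule X(1))
    also have "\<dots> = (\<Sum>\<C>\<in>?F. (det (principal_submatrix (K + outer_prod x x) \<C>) -
        det (principal_submatrix K \<C>)) / ?e)"
    proof (intro sum.cong refl)
      fix \<C> assume C: "\<C> \<in> ?F"
      have "x \<bullet> ((pmf ?p \<C> \<cdot>\<^sub>m ?X \<C>) *\<^sub>v x) = pmf ?p \<C> * (x \<bullet> (?X \<C> *\<^sub>v x))"
        using quadratic_form_smult[OF X(1)[OF C] x] .
      \<comment> \<open>The weight of a subset contains its minor as a factor, which turns the form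
        of the inverse into a difference of minors.\<close>
      also have "\<dots> = det (principal_submatrix K \<C>) * (x \<bullet> (?X \<C> *\<^sub>v x)) / ?e"
        using C by (simp add: pmf)
      also have "\<dots> = (det (principal_submatrix (K + outer_prod x x) \<C>) -
          det (principal_submatrix K \<C>)) / ?e"
        using sampled_inverse(3)[OF pd K _ x, of \<C>] C by simp
      finally show "x \<bullet> ((pmf ?p \<C> \<cdot>\<^sub>m ?X \<C>) *\<^sub>v x) =
          (det (principal_submatrix (K + outer_prod x x) \<C>) - det (principal_submatrix K \<C>)) / ?e" .
    qed
    also have "\<dots> = ((\<Sum>\<C>\<in>?F. det (principal_submatrix (K + outer_prod x x) \<C>)) - ?e) / ?e"
      by (simp add: sum_subtractf minors flip: sum_divide_distrib)
    also have "(\<Sum>\<C>\<in>?F. det (principal_submatrix (K + outer_prod x x) \<C>)) =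
        ?e + (\<Sum>l\<in>{1..n}. (x \<bullet> v l)\<^sup>2 * ?a l)"
      unfolding e unfolding k spectral
      using lam by (rule sum_principal_minors_add_outer_prod[OF v x])
    finally show ?thesis
      by (simp add: sum_divide_distrib mult.commute)
  qed
  have bound: "1 / (lam l + \<alpha>) \<le> ?a l / ?e" if l: "l \<in> {1..n}" for l
  proof -
    \<comment> \<open>Since \<open>k = Suc m\<close>, the indices above \<open>m\<close> are those
      summed in \<alpha>. The larger set \<open>J\<close> is all of \<open>{1..n}\<close>, as
      \<alpha> keeps \<open>lam l\<close> when \<open>k \<le> l\<close> although \<open>l\<close> is
      removed from the subsets.\<close>
    have "{i. i \<in> {1..n} \<and> m < i} = {k..n}"
      by (auto simp: k)
    then have "esym k ({1..n} - {l}) lam \<le> ?a l * \<alpha>"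
      using esym_Suc_le[of "{1..n} - {l}" "{1..n}" lam m] lam
      by (simp add: k assms(8) less_imp_le)
    \<comment> \<open>Inserts the bound for the subsets avoiding \<open>l\<close> into the split of
      \<open>?e\<close> by membership of \<open>l\<close>.\<close>
    then have "?e \<le> ?a l * (lam l + \<alpha>)"
      unfolding e unfolding k using esym_Suc_remove[of "{1..n}" l m lam] l
      by (simp add: algebra_simps)
    moreover have "0 < lam l + \<alpha>"
      using lam[OF l] lam assms(6) unfolding assms(8)
      by (intro add_pos_nonneg sum_nonneg) (auto intro: less_imp_le)
    ultimately show ?thesis
      using e_pos by (simp add: field_simps)
  qed
  have "positive_semidefinite (?E - ?R)"
    unfolding positive_semidefinite_def
  proof (intro conjI ballI)
    have Ec: "?E \<in> carrier_mat n n" unfolding E by simp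
    have "symmetric_mat (pmf ?p \<C> \<cdot>\<^sub>m ?X \<C>)" if "\<C> \<in> ?F" for \<C>
      using X(2)[OF that] by (rule symmetric_mat_smult)
    then have symE: "symmetric_mat ?E"
      unfolding E using X(1) by (intro symmetric_mat_mat_sum) auto
    have symR: "symmetric_mat ?R"
      by (intro symmetric_matI[OF spectral_mat_carrier(1)])
        (simp add: index_spectral_mat[OF v] mult.commute mult.left_commute)
    show "symmetric_mat (?E - ?R)"
      using Ec symmetric_matD[OF symE Ec] symmetric_matD[OF symR spectral_mat_carrier(1)]
      by (intro symmetric_matI[of _ n]) auto
    fix x :: "real vec" assume "x \<in> carrier_vec (dim_row (?E - ?R))"
    then have x: "x \<in> carrier_vec n"
      by simp
    have "x \<bullet> ((?E - ?R) *\<^sub>v x) = x \<bullet> (?E *\<^sub>v x) - x \<bullet> (?R *\<^sub>v x)"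
      using Ec x by (simp add: quadratic_form_diff[of _ n])
    \<comment> \<open>Both forms are diagonal in the basis \<open>v\<close>, so the Loewner
      inequality reduces to the scalar bound for each \<open>l\<close>.\<close>
    also have "\<dots> = (\<Sum>l\<in>{1..n}. (?a l / ?e - 1 / (lam l + \<alpha>)) * (x \<bullet> v l)\<^sup>2)"
      by (simp add: quadratic_E[OF x] quadratic_form_spectral_mat[OF v x] left_diff_distrib sum_subtractf)
    also have "0 \<le> \<dots>"
      using bound by (intro sum_nonneg mult_nonneg_nonneg) auto
    finally show "0 \<le> x \<bullet> ((?E - ?R) *\<^sub>v x)" .
  qed
  then show ?thesis
    unfolding loewner_ge_def spectral_mat_def .
qed

end
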